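(* Let $p$ be an odd prime, let $G$ be a finite $p$-group of nilpotency class $2$ and let $w$ be a word in $k$ variables. Then $N_{w,G}(1)\geq |G|^{k}/|G_w|$.
   Context: A word in $k$ variables is an element $w$ of the free group on $x_1,\dots,x_k$ ($k\ge 1$). For $g_1,\dots,g_k\in G$, $w(g_1,\dots,g_k)$ is the image of $w$ under the homomorphism to $G$ with $x_i\mapsto g_i$. For $g\in G$, $N_{w,G}(g)=|\{(g_1,\dots,g_k)\in G^{k}\mid w(g_1,\dots,g_k)=g\}|$, and $G_w=\{w(g_1,\dots,g_k)\mid g_1,\dots,g_k\in G\}$ is the set of values of $w$ on $G$. *)

theory Defs
  imports "HOL-Algebra.Generated_Groups" "HOL-Computational_Algebra.Primes" Complex_Main
begin

text \<open>
  The free group on a set is realised by reduced words.  The letter \<open>(x, True)\<close> stands for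
  the generator \<open>x\<close> and \<open>(x, False)\<close> for its inverse.
\<close>

type_synonym 'x letter = "'x \<times> bool"

definition flip_letter :: "'x letter \<Rightarrow> 'x letter" where
  "flip_letter a = (fst a, \<not> snd a)"

fun reduced :: "'x letter list \<Rightarrow> bool" where
  "reduced (a # b # u) \<longleftrightarrow> b \<noteq> flip_letter a \<and> reduced (b # u)"
| "reduced _ \<longleftrightarrow> True"

fun cons_letter :: "'x letter \<Rightarrow> 'x letter list \<Rightarrow> 'x letter list" where
  "cons_letter a [] = [a]"
| "cons_letter a (b # u) = (if b = flip_letter a then u else a # b # u)"

definition free_group :: "'x set \<Rightarrow> 'x letter list monoid" where
  "free_group X =
     \<lparr> carrier = {u. reduced u \<and> fst ` set u \<subseteq> X},
       monoid.mult = (\<lambda>u v. foldr cons_letter u v),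
       one = [] \<rparr>"

definition free_gen :: "'x \<Rightarrow> 'x letter list" where
  "free_gen x = [(x, True)]"

definition letter_value :: "('a, 'b) monoid_scheme \<Rightarrow> ('x \<Rightarrow> 'a) \<Rightarrow> 'x letter \<Rightarrow> 'a" where
  "letter_value G g a = (if snd a then g (fst a) else inv\<^bsub>G\<^esub> (g (fst a)))"

text \<open>
  \<open>word_value G g w\<close> is \<open>w(g)\<close>; theorems \<open>word_value_hom\<close>, \<open>word_value_gen\<close> and
  \<open>word_value_unique\<close> below show that \<open>word_value G g\<close> is the homomorphism from the
  free group to \<open>G\<close> with \<open>x \<mapsto> g x\<close>.
\<close>

definition word_value :: "('a, 'b) monoid_scheme \<Rightarrow> ('x \<Rightarrow> 'a) \<Rightarrow> 'x letter list \<Rightarrow> 'a" where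
  "word_value G g w = foldr (\<lambda>a z. letter_value G g a \<otimes>\<^bsub>G\<^esub> z) w \<one>\<^bsub>G\<^esub>"

abbreviation tuples :: "('a, 'b) monoid_scheme \<Rightarrow> nat \<Rightarrow> (nat \<Rightarrow> 'a) set" where
  "tuples G k \<equiv> {1..k} \<rightarrow>\<^sub>E carrier G"

definition word_fibre_count ::
    "('a, 'b) monoid_scheme \<Rightarrow> nat \<Rightarrow> nat letter list \<Rightarrow> 'a \<Rightarrow> nat" where
  "word_fibre_count G k w x = card {g \<in> tuples G k. word_value G g w = x}"

definition word_values ::
    "('a, 'b) monoid_scheme \<Rightarrow> nat \<Rightarrow> nat letter list \<Rightarrow> 'a set" where
  "word_values G k w = {word_value G g w | g. g \<in> tuples G k}"

definition finite_p_group :: "nat \<Rightarrow> ('a, 'b) monoid_scheme \<Rightarrow> bool" where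
  "finite_p_group p G \<longleftrightarrow> group G \<and> finite (carrier G) \<and> (\<exists>n. order G = p ^ n)"

text \<open>
  Lower central series, indexed from 0: \<open>lower_central G n\<close> is the term usually written
  \<open>\<gamma>\<close> with subscript \<open>n + 1\<close>.
\<close>

primrec lower_central :: "('a, 'b) monoid_scheme \<Rightarrow> nat \<Rightarrow> 'a set" where
  "lower_central G 0 = carrier G"
| "lower_central G (Suc n) =
     generate G {a \<otimes>\<^bsub>G\<^esub> b \<otimes>\<^bsub>G\<^esub> inv\<^bsub>G\<^esub> a \<otimes>\<^bsub>G\<^esub> inv\<^bsub>G\<^esub> b | a b. a \<in> lower_central G n \<and> b \<in> carrier G}"

definition has_nilpotency_class :: "('a, 'b) monoid_scheme \<Rightarrow> nat \<Rightarrow> bool" where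
  "has_nilpotency_class G c \<longleftrightarrow>
     lower_central G c = {\<one>\<^bsub>G\<^esub>} \<and> (\<forall>m<c. lower_central G m \<noteq> {\<one>\<^bsub>G\<^esub>})"

lemma flip_flip [simp]: "flip_letter (flip_letter a) = a"
  by (simp add: flip_letter_def)

lemma fst_flip [simp]: "fst (flip_letter a) = fst a"
  by (simp add: flip_letter_def)

lemma flip_neq [simp]: "flip_letter a \<noteq> a" "a \<noteq> flip_letter a"
  by (auto simp: flip_letter_def prod_eq_iff)

lemma reduced_tl: "reduced (a # u) \<Longrightarrow> reduced u"
  by (cases u) auto

lemma reduced_cons_letter: "reduced u \<Longrightarrow> reduced (cons_letter a u)"
  by (cases u) (auto intro: reduced_tl)

lemma reduced_foldr: "reduced v \<Longrightarrow> reduced (foldr cons_letter u v)"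
  by (induction u) (auto intro: reduced_cons_letter)

lemma set_cons_letter: "set (cons_letter a u) \<subseteq> insert a (set u)"
  by (cases u) auto

lemma set_foldr: "set (foldr cons_letter u v) \<subseteq> set u \<union> set v"
  by (induction u) (use set_cons_letter in fastforce)+

lemma cons_flip: "reduced u \<Longrightarrow> cons_letter a (cons_letter (flip_letter a) u) = u"
proof (cases u)
  case (Cons b v)
  then show "reduced u \<Longrightarrow> ?thesis" by (cases v) auto
qed auto

lemma foldr_cons_letter:
  assumes "reduced w"
  shows "foldr cons_letter (cons_letter a v) w = cons_letter a (foldr cons_letter v w)"
proof (cases v)
  case (Cons b v')
  then show ?thesis using cons_flip[OF reduced_foldr[OF assms], of a v'] by auto
qed auto

lemma foldr_assoc:
  "reduced w \<Longrightarrow>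
    foldr cons_letter (foldr cons_letter u v) w = foldr cons_letter u (foldr cons_letter v w)"
  by (induction u) (auto simp: foldr_cons_letter)

lemma foldr_Nil: "reduced u \<Longrightarrow> foldr cons_letter u [] = u"
proof (induction u)
  case (Cons a u)
  then show ?case using reduced_tl[OF Cons.prems] by (cases u) auto
qed auto

lemma foldr_rev_flip: "reduced w \<Longrightarrow>
    foldr cons_letter (map flip_letter (rev u)) (foldr cons_letter u w) = w"
proof (induction u)
  case (Cons a u)
  have "cons_letter (flip_letter a) (cons_letter a (foldr cons_letter u w)) = foldr cons_letter u w"
    using cons_flip[OF reduced_foldr[OF Cons.prems], of "flip_letter a" u] by simp
  then show ?case using Cons by simp
qed auto

theorem group_free_group: "group (free_group X)"
proof (rule groupI)
  fix u v assume "u \<in> carrier (free_group X)" "v \<in> carrier (free_group X)"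
  then show "u \<otimes>\<^bsub>free_group X\<^esub> v \<in> carrier (free_group X)"
    using set_foldr[of u v] by (fastforce simp: free_group_def reduced_foldr)
next
  fix u assume u: "u \<in> carrier (free_group X)"
  let ?v = "foldr cons_letter (map flip_letter (rev u)) []"
  have "foldr cons_letter ?v u = []"
    using u foldr_rev_flip[of "[]" u]
    by (simp add: free_group_def foldr_assoc foldr_Nil)
  moreover have "?v \<in> carrier (free_group X)"
  proof -
    have "fst ` set ?v \<subseteq> fst ` set u"
      using image_mono[OF set_foldr[of "map flip_letter (rev u)" "[]"], of fst]
      by (simp add: image_image)
    then show ?thesis using u by (auto simp: free_group_def reduced_foldr)
  qed
  ultimately show "\<exists>v\<in>carrier (free_group X). v \<otimes>\<^bsub>free_group X\<^esub> u = \<one>\<^bsub>free_group X\<^esub>"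
    by (auto simp: free_group_def)
qed (auto simp: free_group_def foldr_assoc)

lemma free_gen_closed: "x \<in> X \<Longrightarrow> free_gen x \<in> carrier (free_group X)"
  by (simp add: free_group_def free_gen_def)

context group
begin

lemma letter_value_closed:
  "g \<in> X \<rightarrow> carrier G \<Longrightarrow> fst a \<in> X \<Longrightarrow> letter_value G g a \<in> carrier G"
  by (auto simp: letter_value_def)

lemma word_value_closed:
  "g \<in> X \<rightarrow> carrier G \<Longrightarrow> fst ` set u \<subseteq> X \<Longrightarrow> word_value G g u \<in> carrier G"
  by (induction u) (auto simp: word_value_def letter_value_closed)

lemma word_value_cons:
  assumes g: "g \<in> X \<rightarrow> carrier G" and "fst a \<in> X" "fst ` set u \<subseteq> X"
  shows "word_value G g (cons_letter a u) = letter_value G g a \<otimes> word_value G g u"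
proof (cases u)
  case (Cons b v)
  have cl: "word_value G g v \<in> carrier G" "g (fst a) \<in> carrier G"
    using assms Cons word_value_closed[OF g, of v] by auto
  have "letter_value G g a \<otimes> (letter_value G g (flip_letter a) \<otimes> word_value G g v)
      = word_value G g v"
    using cl by (auto simp: letter_value_def flip_letter_def m_assoc[symmetric])
  then show ?thesis using Cons by (auto simp: word_value_def)
qed (simp add: word_value_def)

theorem word_value_hom:
  assumes g: "g \<in> X \<rightarrow> carrier G"
  shows "word_value G g \<in> hom (free_group X) G"
proof (rule homI)
  fix u assume "u \<in> carrier (free_group X)"
  then show "word_value G g u \<in> carrier G"
    using word_value_closed[OF g] by (simp add: free_group_def)
next
  fix u v assume "u \<in> carrier (free_group X)" "v \<in> carrier (free_group X)"
  then have uv: "fst ` set u \<subseteq> X" "fst ` set v \<subseteq> X" by (auto simp: free_group_def)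
  from uv(1) have "word_value G g (foldr cons_letter u v) = word_value G g u \<otimes> word_value G g v"
  proof (induction u)
    case Nil
    then show ?case using word_value_closed[OF g uv(2)] by (simp add: word_value_def)
  next
    case (Cons a u)
    have "fst ` set (foldr cons_letter u v) \<subseteq> X"
      using set_foldr[of u v] Cons.prems uv(2) by fastforce
    then have "word_value G g (foldr cons_letter (a # u) v)
        = letter_value G g a \<otimes> word_value G g (foldr cons_letter u v)"
      using word_value_cons[OF g] Cons.prems by simp
    also have "\<dots> = letter_value G g a \<otimes> (word_value G g u \<otimes> word_value G g v)"
      using Cons by simp
    also have "\<dots> = word_value G g (a # u) \<otimes> word_value G g v"
      using Cons.prems uv(2) letter_value_closed[OF g, of a] word_value_closed[OF g]
      by (simp add: word_value_def m_assoc)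
    finally show ?case .
  qed
  then show "word_value G g (u \<otimes>\<^bsub>free_group X\<^esub> v) = word_value G g u \<otimes> word_value G g v"
    by (simp add: free_group_def)
qed

theorem word_value_gen:
  "g \<in> X \<rightarrow> carrier G \<Longrightarrow> x \<in> X \<Longrightarrow> word_value G g (free_gen x) = g x"
  by (simp add: word_value_def free_gen_def letter_value_def Pi_iff)

theorem word_value_unique:
  assumes g: "g \<in> X \<rightarrow> carrier G" and h: "h \<in> hom (free_group X) G"
    and hx: "\<And>x. x \<in> X \<Longrightarrow> h (free_gen x) = g x"
    and u: "u \<in> carrier (free_group X)"
  shows "h u = word_value G g u"
proof -
  interpret F: group "free_group X" by (rule group_free_group)
  interpret H: group_hom "free_group X" G h
    by (simp add: group_hom_def group_hom_axioms_def group_free_group h)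
  have letter: "h [a] = letter_value G g a" if a: "fst a \<in> X" for a
  proof (cases "snd a")
    case True
    then show ?thesis using hx[OF a] by (cases a) (auto simp: free_gen_def letter_value_def)
  next
    case False
    have c: "[a] \<in> carrier (free_group X)" using a by (simp add: free_group_def)
    have "[a] \<otimes>\<^bsub>free_group X\<^esub> free_gen (fst a) = \<one>\<^bsub>free_group X\<^esub>"
      using False by (simp add: free_group_def free_gen_def flip_letter_def)
    then have "[a] = inv\<^bsub>free_group X\<^esub> free_gen (fst a)"
      using F.inv_equality c free_gen_closed[OF a] by metis
    then show ?thesis
      using False H.hom_inv[OF free_gen_closed[OF a]] hx[OF a] by (simp add: letter_value_def)
  qed
  show ?thesis using u
  proof (induction u)
    case Nil
    have "h \<one>\<^bsub>free_group X\<^esub> = \<one>" by (rule H.hom_one)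
    then show ?case by (simp add: free_group_def word_value_def)
  next
    case (Cons a u)
    have c: "[a] \<in> carrier (free_group X)" "u \<in> carrier (free_group X)" "fst a \<in> X"
      using Cons.prems reduced_tl[of a u] by (auto simp: free_group_def)
    have "a # u = [a] \<otimes>\<^bsub>free_group X\<^esub> u"
      using Cons.prems by (cases u) (auto simp: free_group_def)
    then have "h (a # u) = h [a] \<otimes> h u" using H.hom_mult c by metis
    then show ?case using Cons.IH c letter by (simp add: word_value_def)
  qed
qed

end

end

theory Submission
  imports Defs "HOL-Algebra.Multiplicative_Group"
begin

text \<open>
  It suffices that the fibre of the identity is the largest one. As \<open>G\<close> has odd order, the
  commutator \<open>[x, y]\<close> has a biadditive square root \<open>B x y\<close>, and \<open>x + y = x y B y x\<close> makes \<open>G\<close> an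
  abelian group (Baer's correspondence). In terms of this addition a word map is the sum of an
  integral linear form \<open>f\<close> and a quadratic form \<open>Q\<close> built from \<open>B\<close>. An integral change of the
  variables splits them into two parts such that \<open>f\<close> depends only on the first part and \<open>Q\<close> is
  additive in each part separately. For fixed second part \<open>f + Q\<close> is then a homomorphism
  in the first, so each of its nonempty fibres has the size of its kernel.
\<close>

section \<open>Alternating forms on abelian groups\<close>

text \<open>\<open>L\<close> will be the Baer group, written multiplicatively, and \<open>B\<close>
  the halved commutator; so \<open>B\<close> takes its values in the same group as its
  arguments.\<close>

locale alternating_comm_group = comm_group L for L (structure) +
  fixes B :: "'a \<Rightarrow> 'a \<Rightarrow> 'a"
  assumes B_closed [simp, intro]: "x \<in> carrier L \<Longrightarrow> y \<in> carrier L \<Longrightarrow> B x y \<in> carrier L"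
    and B_mult_left: "x \<in> carrier L \<Longrightarrow> y \<in> carrier L \<Longrightarrow> z \<in> carrier L \<Longrightarrow>
      B (x \<otimes> y) z = B x z \<otimes> B y z"
    and B_mult_right: "x \<in> carrier L \<Longrightarrow> y \<in> carrier L \<Longrightarrow> z \<in> carrier L \<Longrightarrow>
      B x (y \<otimes> z) = B x y \<otimes> B x z"
    and B_self: "x \<in> carrier L \<Longrightarrow> B x x = \<one>"
begin

lemma B_one_left [simp]: "x \<in> carrier L \<Longrightarrow> B \<one> x = \<one>"
  using B_mult_left[of \<one> \<one> x] by simp

lemma B_one_right [simp]: "x \<in> carrier L \<Longrightarrow> B x \<one> = \<one>"
  using B_mult_right[of x \<one> \<one>] by simp

text \<open>Polarisation: in the expansion of \<open>B (y \<otimes> x) (y \<otimes> x)\<close> both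
  the diagonal terms and the total vanish, so the two mixed terms cancel.\<close>

lemma B_swap:
  assumes "x \<in> carrier L" "y \<in> carrier L"
  shows "B y x = inv (B x y)"
proof -
  have "B (y \<otimes> x) (y \<otimes> x) = B y x \<otimes> B x y"
    unfolding B_mult_left[OF assms(2,1) m_closed[OF assms(2,1)]]
    using assms B_self[OF assms(1)] B_self[OF assms(2)] by (simp add: B_mult_right)
  moreover have "B (y \<otimes> x) (y \<otimes> x) = \<one>"
    using assms by (intro B_self) simp
  ultimately show ?thesis using assms inv_equality[of "B y x" "B x y"] by simp
qed

lemma B_inv_right:
  assumes "x \<in> carrier L" "y \<in> carrier L"
  shows "B x (inv y) = inv (B x y)"
  using assms B_mult_right[of x "inv y" y] inv_equality[of "B x (inv y)" "B x y"] by simp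

lemma B_pow_right:
  assumes "x \<in> carrier L" "y \<in> carrier L"
  shows "B x (y [^] (n::int)) = B x y [^] n"
proof -
  have nat: "B x (y [^] (j::nat)) = B x y [^] j" for j
    using assms by (induction j) (simp_all add: B_mult_right)
  show ?thesis
  proof (cases n)
    case (nonneg j)
    then show ?thesis by (simp add: nat int_pow_int)
  next
    case (neg j)
    then show ?thesis using assms
      by (simp only: int_pow_neg_int nat_pow_closed B_closed B_inv_right nat)
  qed
qed

lemma B_pow_left:
  assumes "x \<in> carrier L" "y \<in> carrier L"
  shows "B (x [^] (n::int)) y = B x y [^] n"
  using assms B_swap[of y "x [^] n"] B_swap[of y x] B_pow_right[of y x n] by (simp add: int_pow_inv)

section \<open>Integral linear forms and quadratic forms\<close>

text \<open>Integral linear forms in the variables \<open>x i\<close> with \<open>i \<in> V\<close>,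
  presented by generation instead of coefficient vectors, so that their properties follow by rule
  induction.\<close>

inductive_set lin :: "'i set \<Rightarrow> (('i \<Rightarrow> 'a) \<Rightarrow> 'a) set" for V where
  lin_one: "(\<lambda>x. \<one>) \<in> lin V"
| lin_proj: "i \<in> V \<Longrightarrow> (\<lambda>x. x i) \<in> lin V"
| lin_mult: "f \<in> lin V \<Longrightarrow> g \<in> lin V \<Longrightarrow> (\<lambda>x. f x \<otimes> g x) \<in> lin V"
| lin_inv: "f \<in> lin V \<Longrightarrow> (\<lambda>x. inv (f x)) \<in> lin V"

text \<open>A minus sign can be absorbed into an argument of \<open>B\<close>, so inverses are
  covered by these rules as well.\<close>

inductive_set quad :: "'i set \<Rightarrow> (('i \<Rightarrow> 'a) \<Rightarrow> 'a) set" for V where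
  quad_one: "(\<lambda>x. \<one>) \<in> quad V"
| quad_B: "f \<in> lin V \<Longrightarrow> g \<in> lin V \<Longrightarrow> (\<lambda>x. B (f x) (g x)) \<in> quad V"
| quad_mult: "f \<in> quad V \<Longrightarrow> g \<in> quad V \<Longrightarrow> (\<lambda>x. f x \<otimes> g x) \<in> quad V"

lemma lin_closed: "f \<in> lin V \<Longrightarrow> x \<in> V \<rightarrow> carrier L \<Longrightarrow> f x \<in> carrier L"
  by (induction rule: lin.induct) auto

lemma quad_closed: "Q \<in> quad V \<Longrightarrow> x \<in> V \<rightarrow> carrier L \<Longrightarrow> Q x \<in> carrier L"
  by (induction rule: quad.induct) (auto simp: lin_closed)

lemma lin_subst:
  assumes "f \<in> lin V" and "\<And>i. i \<in> V \<Longrightarrow> (\<lambda>x. T x i) \<in> lin W"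
  shows "(\<lambda>x. f (T x)) \<in> lin W"
  using assms by (induction rule: lin.induct) (auto intro: lin.intros)

lemma quad_subst:
  assumes "Q \<in> quad V" and "\<And>i. i \<in> V \<Longrightarrow> (\<lambda>x. T x i) \<in> lin W"
  shows "(\<lambda>x. Q (T x)) \<in> quad W"
  using assms(1)
proof (induction rule: quad.induct)
  case (quad_B f g)
  show ?case
    by (rule quad.quad_B[OF lin_subst[OF quad_B(1) assms(2)] lin_subst[OF quad_B(2) assms(2)]])
next
  case (quad_mult Q R)
  show ?case by (rule quad.quad_mult[OF quad_mult.IH])
qed (rule quad.quad_one)

lemma lin_mono: "f \<in> lin V \<Longrightarrow> V \<subseteq> W \<Longrightarrow> f \<in> lin W"
  using lin_subst[of f V "\<lambda>x. x" W] by (auto intro: lin_proj)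

lemma lin_pow:
  assumes "f \<in> lin V"
  shows "(\<lambda>x. f x [^] (n::int)) \<in> lin V"
proof -
  have pow: "(\<lambda>x. f x [^] (j::nat)) \<in> lin V" for j
  proof (induction j)
    case 0
    show ?case by (simp add: lin_one)
  next
    case (Suc j)
    then show ?case unfolding nat_pow_Suc by (rule lin_mult[OF _ assms])
  qed
  show ?thesis
  proof (cases "n < 0")
    case True
    then show ?thesis using lin_inv[OF pow[of "nat (- n)"]] by (subst int_pow_def2) simp
  next
    case False
    then show ?thesis using pow[of "nat n"] by (subst int_pow_def2) simp
  qed
qed

lemma lin_hom:
  assumes "f \<in> lin V" "x \<in> V \<rightarrow> carrier L" "y \<in> V \<rightarrow> carrier L"
  shows "f (\<lambda>i. x i \<otimes> y i) = f x \<otimes> f y"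
  using assms
proof (induction rule: lin.induct)
  case (lin_mult f g)
  then have "f x \<in> carrier L" "f y \<in> carrier L" "g x \<in> carrier L" "g y \<in> carrier L"
    using lin_closed[of f V] lin_closed[of g V] by auto
  then show ?case using lin_mult by (simp add: m_ac)
next
  case (lin_inv f)
  then have "f x \<in> carrier L" "f y \<in> carrier L" using lin_closed[of f V] by auto
  then show ?case using lin_inv by (simp add: inv_mult)
qed auto

lemma lin_empty: "f \<in> lin {} \<Longrightarrow> f x = \<one>"
  by (induction rule: lin.induct) auto

lemma quad_empty: "Q \<in> quad {} \<Longrightarrow> Q x = \<one>"
  by (induction rule: quad.induct) (auto simp: lin_empty)

text \<open>Splits off one variable with its integer coefficient, for inductions that remove the
  variables one at a time.\<close>

lemma lin_insert:
  assumes "f \<in> lin (insert v V)"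
  shows "\<exists>g\<in>lin V. \<exists>n::int. \<forall>x\<in>insert v V \<rightarrow> carrier L. f x = x v [^] n \<otimes> g x"
  using assms
proof (induction rule: lin.induct)
  case lin_one
  show ?case by (intro bexI[of _ "\<lambda>x. \<one>"] exI[of _ 0]) (simp_all add: lin.lin_one)
next
  case (lin_proj i)
  show ?case
  proof (cases "i = v")
    case True
    then show ?thesis
      by (intro bexI[of _ "\<lambda>x. \<one>"] exI[of _ 1]) (simp_all add: lin.lin_one Pi_iff)
  next
    case False
    then show ?thesis using lin_proj
      by (intro bexI[of _ "\<lambda>x. x i"] exI[of _ 0]) (auto simp: lin.lin_proj Pi_iff)
  qed
next
  case (lin_mult f1 f2)
  then obtain g1 g2 and n1 n2 :: int where g: "g1 \<in> lin V" "g2 \<in> lin V"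
    and eq: "\<And>x. x \<in> insert v V \<rightarrow> carrier L \<Longrightarrow> f1 x = x v [^] n1 \<otimes> g1 x"
      "\<And>x. x \<in> insert v V \<rightarrow> carrier L \<Longrightarrow> f2 x = x v [^] n2 \<otimes> g2 x" by metis
  have "f1 x \<otimes> f2 x = x v [^] (n1 + n2) \<otimes> (g1 x \<otimes> g2 x)" if x: "x \<in> insert v V \<rightarrow> carrier L" for x
  proof -
    have "x v \<in> carrier L" "g1 x \<in> carrier L" "g2 x \<in> carrier L"
      using x g lin_closed[of _ V x] by auto
    then show ?thesis using eq[OF x] by (simp add: int_pow_mult m_ac)
  qed
  then show ?case
    by (intro bexI[of _ "\<lambda>x. g1 x \<otimes> g2 x"] exI[of _ "n1 + n2"] ballI) (simp_all add: lin.lin_mult[OF g])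
next
  case (lin_inv f)
  then obtain g and n :: int where g: "g \<in> lin V"
    and eq: "\<And>x. x \<in> insert v V \<rightarrow> carrier L \<Longrightarrow> f x = x v [^] n \<otimes> g x" by metis
  have "inv (f x) = x v [^] (- n) \<otimes> inv (g x)" if x: "x \<in> insert v V \<rightarrow> carrier L" for x
  proof -
    have "x v \<in> carrier L" "g x \<in> carrier L"
      using x g lin_closed[of _ V x] by auto
    then show ?thesis using eq[OF x] by (simp add: int_pow_neg inv_mult)
  qed
  then show ?case
    by (intro bexI[of _ "\<lambda>x. inv (g x)"] exI[of _ "- n"] ballI) (simp_all add: lin.lin_inv[OF g])
qed

text \<open>The variable \<open>x v\<close> enters only to the first degree, because
  \<open>B (x v) (x v)\<close> vanishes; its cofactor is therefore a linear form \<open>g\<close> in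
  the other variables.\<close>

lemma quad_insert:
  assumes "Q \<in> quad (insert v V)"
  shows "\<exists>g\<in>lin V. \<exists>R\<in>quad V. \<forall>x\<in>insert v V \<rightarrow> carrier L. Q x = B (x v) (g x) \<otimes> R x"
  using assms
proof (induction rule: quad.induct)
  case quad_one
  show ?case
    by (intro bexI[of _ "\<lambda>x. \<one>"]) (simp_all add: lin.lin_one quad.quad_one Pi_iff)
next
  case (quad_B f1 f2)
  then obtain g1 g2 and n1 n2 :: int where g: "g1 \<in> lin V" "g2 \<in> lin V"
    and eq: "\<And>x. x \<in> insert v V \<rightarrow> carrier L \<Longrightarrow> f1 x = x v [^] n1 \<otimes> g1 x"
      "\<And>x. x \<in> insert v V \<rightarrow> carrier L \<Longrightarrow> f2 x = x v [^] n2 \<otimes> g2 x"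
    using lin_insert[OF quad_B(1)] lin_insert[OF quad_B(2)] by metis
  \<comment> \<open>In the biadditive expansion the term with \<open>n1 * n2\<close> is diagonal and
    vanishes. Antisymmetry moves \<open>x v\<close> to the front of \<open>B (g1 x) (x v)\<close>,
    which puts the inverse on \<open>g1\<close>.\<close>
  have "B (f1 x) (f2 x) = B (x v) (g2 x [^] n1 \<otimes> inv (g1 x [^] n2)) \<otimes> B (g1 x) (g2 x)"
    if x: "x \<in> insert v V \<rightarrow> carrier L" for x
  proof -
    have cl: "x v \<in> carrier L" "g1 x \<in> carrier L" "g2 x \<in> carrier L"
      using x g lin_closed[of _ V x] by auto
    have "B (f1 x) (f2 x) = B (x v) (g2 x) [^] n1 \<otimes> B (g1 x) (x v) [^] n2 \<otimes> B (g1 x) (g2 x)"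
      unfolding eq[OF x] using cl
      by (simp add: B_mult_left B_mult_right B_pow_left B_pow_right B_self m_ac)
    also have "B (g1 x) (x v) [^] n2 = inv (B (x v) (g1 x [^] n2))"
      using cl B_swap[of "x v" "g1 x"] by (simp add: B_pow_right int_pow_inv)
    finally show ?thesis using cl by (simp add: B_mult_right B_inv_right B_pow_right)
  qed
  moreover have "(\<lambda>x. g2 x [^] n1 \<otimes> inv (g1 x [^] n2)) \<in> lin V"
    by (intro lin.intros lin_pow g)
  ultimately show ?case
    by (intro bexI[of _ "\<lambda>x. g2 x [^] n1 \<otimes> inv (g1 x [^] n2)"] bexI[of _ "\<lambda>x. B (g1 x) (g2 x)"] ballI)
      (simp_all add: quad.quad_B[OF g])
next
  case (quad_mult Q1 Q2)
  then obtain g1 g2 R1 R2 where g: "g1 \<in> lin V" "g2 \<in> lin V" and R: "R1 \<in> quad V" "R2 \<in> quad V"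
    and eq: "\<And>x. x \<in> insert v V \<rightarrow> carrier L \<Longrightarrow> Q1 x = B (x v) (g1 x) \<otimes> R1 x"
      "\<And>x. x \<in> insert v V \<rightarrow> carrier L \<Longrightarrow> Q2 x = B (x v) (g2 x) \<otimes> R2 x" by meson
  have "Q1 x \<otimes> Q2 x = B (x v) (g1 x \<otimes> g2 x) \<otimes> (R1 x \<otimes> R2 x)"
    if x: "x \<in> insert v V \<rightarrow> carrier L" for x
  proof -
    have "x v \<in> carrier L" "g1 x \<in> carrier L" "g2 x \<in> carrier L" "R1 x \<in> carrier L" "R2 x \<in> carrier L"
      using x g R lin_closed[of _ V x] quad_closed[of _ V x] by auto
    then show ?thesis using eq[OF x] by (simp add: B_mult_right m_ac)
  qed
  then show ?case
    by (intro bexI[of _ "\<lambda>x. g1 x \<otimes> g2 x"] bexI[of _ "\<lambda>x. R1 x \<otimes> R2 x"] ballI)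
      (simp_all add: lin.lin_mult[OF g] quad.quad_mult[OF R])
qed

section \<open>Integral changes of variables\<close>

text \<open>An invertible integral substitution. Invertibility is recorded as injectivity on points
  instead of unimodularity of a matrix. Fixing the coordinates outside \<open>V\<close> lets a
  change of few variables act on a larger set of them.\<close>

definition lin_inj :: "'i set \<Rightarrow> (('i \<Rightarrow> 'a) \<Rightarrow> ('i \<Rightarrow> 'a)) \<Rightarrow> bool" where
  "lin_inj V T \<longleftrightarrow> (\<forall>i\<in>V. (\<lambda>x. T x i) \<in> lin V) \<and> (\<forall>x. \<forall>i. i \<notin> V \<longrightarrow> T x i = x i) \<and>
     inj_on T (V \<rightarrow> carrier L)"

lemma lin_inj_lin: "lin_inj V T \<Longrightarrow> V \<subseteq> W \<Longrightarrow> i \<in> W \<Longrightarrow> (\<lambda>x. T x i) \<in> lin W"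
  by (cases "i \<in> V") (auto simp: lin_inj_def intro: lin_mono lin_proj)

lemma lin_inj_closed: "lin_inj V T \<Longrightarrow> V \<subseteq> W \<Longrightarrow> x \<in> W \<rightarrow> carrier L \<Longrightarrow> T x \<in> W \<rightarrow> carrier L"
  using lin_closed[OF lin_inj_lin, of V T W _ x] by blast

lemma lin_inj_mono:
  assumes "lin_inj V T" "V \<subseteq> W"
  shows "lin_inj W T"
proof -
  \<comment> \<open>Function spaces \<open>\<rightarrow>\<close> constrain only the values on the
    index set, so the one over \<open>W\<close> is contained in the one over
    \<open>V\<close>.\<close>
  have "inj_on T (W \<rightarrow> carrier L)"
    by (rule inj_on_subset[of T "V \<rightarrow> carrier L"]) (use assms in \<open>auto simp: lin_inj_def\<close>)
  moreover have "T x i = x i" if "i \<notin> W" for x i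
    using assms that by (auto simp: lin_inj_def)
  ultimately show ?thesis using lin_inj_lin[OF assms] by (auto simp: lin_inj_def)
qed

lemma lin_inj_comp:
  assumes "lin_inj V S" "lin_inj V T"
  shows "lin_inj V (\<lambda>x. S (T x))"
proof -
  have "inj_on (S \<circ> T) (V \<rightarrow> carrier L)"
    using assms lin_inj_closed[OF assms(2) order_refl]
    by (intro comp_inj_on) (auto simp: lin_inj_def intro: inj_on_subset)
  moreover have "(\<lambda>x. S (T x) i) \<in> lin V" if "i \<in> V" for i
    using lin_subst[of "\<lambda>x. S x i" V T V] assms that by (auto simp: lin_inj_def)
  ultimately show ?thesis using assms by (simp add: lin_inj_def comp_def)
qed

lemma lin_inj_id: "lin_inj V (\<lambda>x. x)"
  by (auto simp: lin_inj_def intro: lin_proj)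

text \<open>Extensional assignments form a finite set, and \<open>T\<close> preserves extensionality
  as it fixes coordinates outside \<open>V\<close>; an injective self-map of a finite set is
  onto.\<close>

lemma lin_inj_bij_betw:
  assumes "lin_inj V T" "finite V" "finite (carrier L)"
  shows "bij_betw T (V \<rightarrow>\<^sub>E carrier L) (V \<rightarrow>\<^sub>E carrier L)"
proof -
  have "T ` (V \<rightarrow>\<^sub>E carrier L) \<subseteq> V \<rightarrow>\<^sub>E carrier L"
  proof (rule image_subsetI)
    fix x assume x: "x \<in> V \<rightarrow>\<^sub>E carrier L"
    then have "T x \<in> V \<rightarrow> carrier L"
      using lin_inj_closed[OF assms(1) order_refl] by (simp add: PiE_def)
    moreover have "T x \<in> extensional V"
      using assms(1) x by (simp add: lin_inj_def PiE_def extensional_def)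
    ultimately show "T x \<in> V \<rightarrow>\<^sub>E carrier L" by (simp add: PiE_def)
  qed
  moreover have "inj_on T (V \<rightarrow>\<^sub>E carrier L)"
    using assms(1) by (auto simp: lin_inj_def PiE_def intro: inj_on_subset)
  ultimately show ?thesis
    using endo_inj_surj[of "V \<rightarrow>\<^sub>E carrier L" T] assms by (simp add: finite_PiE bij_betw_def)
qed

text \<open>One elimination step over the integers: a substitution built from Bezout coefficients
  merges two terms into a single one, whose coefficient is the gcd.\<close>

lemma bezout_two_variables:
  assumes "u \<in> V" "v \<in> V" "u \<noteq> v"
  shows "\<exists>T. lin_inj V T \<and> (\<exists>n::int. \<forall>x\<in>V \<rightarrow> carrier L.
    T x u [^] (c::int) \<otimes> T x v [^] (d::int) = x v [^] n)"
proof (cases "c = 0 \<and> d = 0")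
  case True
  then show ?thesis by (intro exI[of _ "\<lambda>x. x"] conjI exI[of _ 0]) (auto simp: lin_inj_id)
next
  case False
  define h where "h = gcd c d"
  have h: "h \<noteq> 0" using False by (simp add: h_def)
  obtain q r where qr: "q * c + r * d = h" unfolding h_def using bezout_int by blast
  obtain c' d' where cd: "c = h * c'" "d = h * d'" unfolding h_def by (meson dvdE gcd_dvd1 gcd_dvd2)
  have "h * (q * c' + r * d') = h * 1" using qr by (simp add: cd algebra_simps)
  then have det: "q * c' + r * d' = 1" using h by simp
  \<comment> \<open>Inserted into the form with coefficients \<open>c\<close> and \<open>d\<close>,
    this gives \<open>x v\<close> the coefficient \<open>q * c + r * d = h\<close> and
    \<open>x u\<close> the coefficient \<open>d' * c - c' * d = 0\<close>. The determinant is
    \<open>q * c' + r * d' = 1\<close> up to sign.\<close>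
  define T where "T x = x(u := x v [^] q \<otimes> x u [^] d', v := x v [^] r \<otimes> x u [^] (- c'))" for x
  have pow: "(a [^] i \<otimes> b [^] j) [^] n = a [^] (i * n) \<otimes> b [^] (j * n)"
    if "a \<in> carrier L" "b \<in> carrier L" for a b and i j n :: int
    using that by (simp add: int_pow_distrib int_pow_pow)
  have comb: "T x u [^] i \<otimes> T x v [^] j = x v [^] (q * i + r * j) \<otimes> x u [^] (d' * i - c' * j)"
    if "x \<in> V \<rightarrow> carrier L" for x and i j :: int
  proof -
    have x: "x u \<in> carrier L" "x v \<in> carrier L" using that assms by auto
    have "T x u [^] i \<otimes> T x v [^] j
        = (x v [^] (q * i) \<otimes> x u [^] (d' * i)) \<otimes> (x v [^] (r * j) \<otimes> x u [^] (- c' * j))"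
      using x assms(3) by (simp add: T_def pow del: mult_minus_left)
    also have "\<dots> = (x v [^] (q * i) \<otimes> x v [^] (r * j)) \<otimes> (x u [^] (d' * i) \<otimes> x u [^] (- c' * j))"
      using x by (simp add: m_ac del: mult_minus_left)
    finally show ?thesis using x by (simp add: int_pow_mult[symmetric])
  qed
  have "inj_on T (V \<rightarrow> carrier L)"
  proof (rule inj_onI)
    fix x y assume x: "x \<in> V \<rightarrow> carrier L" and y: "y \<in> V \<rightarrow> carrier L" and eq: "T x = T y"
    have cl: "x u \<in> carrier L" "x v \<in> carrier L" "y u \<in> carrier L" "y v \<in> carrier L"
      using x y assms by auto
    \<comment> \<open>The exponent pairs \<open>(c', d')\<close> and \<open>(r, - q)\<close> are the
      rows of the inverse matrix: they recover \<open>x v\<close> and \<open>x u\<close> from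
      \<open>T x\<close>.\<close>
    have "x v = y v"
      using comb[OF x, of c' d'] comb[OF y, of c' d'] cl det eq by (simp add: mult.commute)
    moreover have "x u = y u"
      using comb[OF x, of r "- q"] comb[OF y, of r "- q"] cl det eq
      by (simp add: mult.commute add.commute)
    moreover have "x i = y i" if "i \<noteq> u" "i \<noteq> v" for i
      using fun_cong[OF eq, of i] that by (simp add: T_def)
    ultimately show "x = y" by (metis ext)
  qed
  moreover have "(\<lambda>x. T x i) \<in> lin V" if "i \<in> V" for i
  proof -
    have u: "(\<lambda>x. T x u) \<in> lin V" and v: "(\<lambda>x. T x v) \<in> lin V"
      unfolding T_def using assms by (simp_all add: lin.lin_mult lin_pow lin.lin_proj)
    show ?thesis
    proof (cases "i = u \<or> i = v")
      case False
      then show ?thesis using that by (simp add: T_def lin.lin_proj)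
    qed (use u v in auto)
  qed
  moreover have "T x i = x i" if "i \<notin> V" for x i using assms that by (auto simp: T_def)
  ultimately have "lin_inj V T" by (simp add: lin_inj_def)
  moreover have "T x u [^] c \<otimes> T x v [^] d = x v [^] h" if "x \<in> V \<rightarrow> carrier L" for x
  proof -
    have "d' * c - c' * d = 0" by (simp add: cd)
    then show ?thesis using comb[OF that, of c d] that assms qr by (auto simp: Pi_iff)
  qed
  ultimately show ?thesis by (intro exI[of _ T] conjI exI[of _ h] ballI)
qed

text \<open>Euclidean elimination: by induction the part of \<open>f\<close> without
  \<open>u\<close> collapses to a power of \<open>x v\<close>, and a Bezout step then merges the
  term of \<open>u\<close> into it.\<close>

lemma lin_single_variable:
  assumes "finite V" "v \<notin> V" "f \<in> lin (insert v V)"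
  shows "\<exists>T. lin_inj (insert v V) T \<and>
    (\<exists>n::int. \<forall>x\<in>insert v V \<rightarrow> carrier L. f (T x) = x v [^] n)"
  using assms
proof (induction V arbitrary: f rule: finite_induct)
  case empty
  then obtain g and n :: int where g: "g \<in> lin {}"
    and f: "\<forall>x\<in>{v} \<rightarrow> carrier L. f x = x v [^] n \<otimes> g x"
    using lin_insert[OF empty.prems(2)] by (elim bexE exE) (rule that)
  have "f x = x v [^] n" if "x \<in> {v} \<rightarrow> carrier L" for x
    using f[rule_format, OF that] that lin_empty[OF g, of x] by (simp add: Pi_iff)
  then show ?case using lin_inj_id by (intro exI[of _ "\<lambda>x. x"] conjI exI[of _ n] ballI)
next
  case (insert u V)
  let ?W = "insert v V" and ?U = "insert u (insert v V)"
  obtain g and c :: int where g: "g \<in> lin ?W"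
    and f: "\<forall>x\<in>?U \<rightarrow> carrier L. f x = x u [^] c \<otimes> g x"
    using lin_insert[OF insert.prems(2)[unfolded insert_commute[of v]]]
    by (elim bexE exE) (rule that)
  have "v \<notin> V" "u \<noteq> v" using insert.prems by auto
  obtain T1 and d :: int where T1: "lin_inj ?W T1"
    and gT1: "\<forall>x\<in>?W \<rightarrow> carrier L. g (T1 x) = x v [^] d"
    using insert.IH[OF \<open>v \<notin> V\<close> g] by (elim conjE exE) (rule that)
  obtain T2 and n :: int where T2: "lin_inj ?U T2"
    and n: "\<forall>x\<in>?U \<rightarrow> carrier L. T2 x u [^] c \<otimes> T2 x v [^] d = x v [^] n"
    using bezout_two_variables[of u ?U v c d, OF insertI1 insertI2[OF insertI1] \<open>u \<noteq> v\<close>]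
    by (elim conjE exE) (rule that)
  have "f (T1 (T2 x)) = x v [^] n" if x: "x \<in> ?U \<rightarrow> carrier L" for x
  proof -
    have cl: "T2 x \<in> ?U \<rightarrow> carrier L" by (rule lin_inj_closed[OF T2 order_refl x])
    then have cl': "T2 x \<in> ?W \<rightarrow> carrier L" by simp
    have cl1: "T1 (T2 x) \<in> ?U \<rightarrow> carrier L" by (rule lin_inj_closed[OF T1 _ cl]) auto
    have "T1 (T2 x) u = T2 x u" using T1 insert.hyps \<open>u \<noteq> v\<close> by (simp add: lin_inj_def)
    then have "f (T1 (T2 x)) = T2 x u [^] c \<otimes> T2 x v [^] d"
      using f[rule_format, OF cl1] gT1[rule_format, OF cl'] by simp
    then show ?thesis using n[rule_format, OF x] by simp
  qed
  moreover have "lin_inj ?U (\<lambda>x. T1 (T2 x))"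
    by (rule lin_inj_comp[OF lin_inj_mono[OF T1 subset_insertI] T2])
  ultimately show ?case unfolding insert_commute[of v]
    by (intro exI[of _ "\<lambda>x. T1 (T2 x)"] conjI exI[of _ n] ballI)
qed

section \<open>Additivity in a part of the variables\<close>

text \<open>\<open>F\<close> is a homomorphism in the coordinates from \<open>S\<close> while those
  in \<open>V - S\<close> are frozen. The relation between \<open>x\<close>, \<open>y\<close> and
  \<open>z\<close> replaces an operation that adds assignments only on \<open>S\<close>.\<close>

definition additive_on :: "'i set \<Rightarrow> 'i set \<Rightarrow> (('i \<Rightarrow> 'a) \<Rightarrow> 'a) \<Rightarrow> bool" where
  "additive_on V S F \<longleftrightarrow> (\<forall>x\<in>V \<rightarrow> carrier L. \<forall>y\<in>V \<rightarrow> carrier L. \<forall>z\<in>V \<rightarrow> carrier L.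
     (\<forall>i\<in>S. z i = x i \<otimes> y i) \<longrightarrow> (\<forall>i\<in>V - S. z i = x i \<and> y i = x i) \<longrightarrow> F z = F x \<otimes> F y)"

lemma additive_onD:
  assumes "additive_on V S F"
    and "x \<in> V \<rightarrow> carrier L" "y \<in> V \<rightarrow> carrier L" "z \<in> V \<rightarrow> carrier L"
    and "\<And>i. i \<in> S \<Longrightarrow> z i = x i \<otimes> y i"
    and "\<And>i. i \<in> V \<Longrightarrow> i \<notin> S \<Longrightarrow> z i = x i \<and> y i = x i"
  shows "F z = F x \<otimes> F y"
  using assms unfolding additive_on_def by blast

text \<open>On \<open>S\<close> the assignment \<open>z\<close> agrees with the full pointwise
  product of \<open>x\<close> and \<open>y\<close>, and \<open>f\<close> sees nothing else.\<close>

lemma lin_additive_on: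
  assumes f: "f \<in> lin V"
    and dep: "\<And>x y. x \<in> V \<rightarrow> carrier L \<Longrightarrow> y \<in> V \<rightarrow> carrier L \<Longrightarrow> (\<And>i. i \<in> S \<Longrightarrow> x i = y i) \<Longrightarrow> f x = f y"
  shows "additive_on V S f"
  unfolding additive_on_def
proof (intro ballI impI)
  fix x y z assume x: "x \<in> V \<rightarrow> carrier L" and y: "y \<in> V \<rightarrow> carrier L" and z: "z \<in> V \<rightarrow> carrier L"
    and "\<forall>i\<in>S. z i = x i \<otimes> y i"
  then have "f z = f (\<lambda>i. x i \<otimes> y i)" by (intro dep) auto
  then show "f z = f x \<otimes> f y" using lin_hom[OF f x y] by simp
qed

text \<open>
  Once \<open>f\<close> has been made a power of the single variable \<open>x v\<close>, the part of \<open>Q\<close> involving \<open>x v\<close> is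
  \<open>B (x v) (g x)\<close>. Splitting the remaining variables for \<open>g\<close> and exchanging the two parts
  puts \<open>v\<close> opposite to the variables on which \<open>g\<close> depends; this amounts to tridiagonalising \<open>Q\<close>.
\<close>

lemma lagrangian_splitting:
  assumes "finite V" "f \<in> lin V" "Q \<in> quad V"
  shows "\<exists>T S. lin_inj V T \<and> S \<subseteq> V \<and>
    (\<forall>x\<in>V \<rightarrow> carrier L. \<forall>y\<in>V \<rightarrow> carrier L. (\<forall>i\<in>S. x i = y i) \<longrightarrow> f (T x) = f (T y)) \<and>
    additive_on V S (\<lambda>x. Q (T x)) \<and> additive_on V (V - S) (\<lambda>x. Q (T x))"
  using assms
proof (induction V arbitrary: f Q rule: finite_induct)
  case empty
  show ?case
    using lin_inj_id lin_empty[OF empty(1)] quad_empty[OF empty(2)]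
    by (intro exI[of _ "\<lambda>x. x"] exI[of _ "{}"]) (simp add: additive_on_def)
next
  case (insert v V)
  let ?W = "insert v V"
  obtain T1 and n :: int where T1: "lin_inj ?W T1"
    and fT1: "\<forall>x\<in>?W \<rightarrow> carrier L. f (T1 x) = x v [^] n"
    using lin_single_variable[OF insert.hyps(1,2) insert.prems(1)] by (elim conjE exE) (rule that)
  have "(\<lambda>x. Q (T1 x)) \<in> quad ?W"
    by (rule quad_subst[OF insert.prems(2) lin_inj_lin[OF T1 order_refl]])
  from quad_insert[OF this] obtain g R where g: "g \<in> lin V" and R: "R \<in> quad V"
    and QT1: "\<forall>x\<in>?W \<rightarrow> carrier L. Q (T1 x) = B (x v) (g x) \<otimes> R x"
    by (elim bexE) (rule that)
  obtain T2 S where T2: "lin_inj V T2" and S: "S \<subseteq> V"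
    and dep': "\<forall>x\<in>V \<rightarrow> carrier L. \<forall>y\<in>V \<rightarrow> carrier L. (\<forall>i\<in>S. x i = y i) \<longrightarrow> g (T2 x) = g (T2 y)"
    and R1: "additive_on V S (\<lambda>x. R (T2 x))" and R2: "additive_on V (V - S) (\<lambda>x. R (T2 x))"
    using insert.IH[OF g R] by (elim exE conjE) (rule that)
  note dep = dep'[rule_format]
  \<comment> \<open>As \<open>v\<close> lies outside \<open>V\<close>, the second change of
    variables preserves the shape of \<open>f\<close> achieved by the first.\<close>
  have T2v: "T2 x v = x v" for x using T2 insert.hyps by (auto simp: lin_inj_def)
  have g1: "additive_on V S (\<lambda>x. g (T2 x))"
  proof (rule lin_additive_on[OF _ dep])
    show "(\<lambda>x. g (T2 x)) \<in> lin V"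
      by (rule lin_subst[OF g lin_inj_lin[OF T2 order_refl]])
  qed
  let ?T = "\<lambda>x. T1 (T2 x)"
  have cl2: "T2 x \<in> ?W \<rightarrow> carrier L" if "x \<in> ?W \<rightarrow> carrier L" for x
    by (rule lin_inj_closed[OF T2 subset_insertI that])
  have fT: "f (?T x) = x v [^] n" if "x \<in> ?W \<rightarrow> carrier L" for x
    using fT1[rule_format, OF cl2[OF that]] T2v by simp
  have QT: "Q (?T x) = B (x v) (g (T2 x)) \<otimes> R (T2 x)" if "x \<in> ?W \<rightarrow> carrier L" for x
    using QT1[rule_format, OF cl2[OF that]] T2v by simp
  have cl: "x v \<in> carrier L" "g (T2 x) \<in> carrier L" "R (T2 x) \<in> carrier L" "x \<in> V \<rightarrow> carrier L"
    if "x \<in> ?W \<rightarrow> carrier L" for x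
    using that cl2[OF that] lin_closed[OF g, of "T2 x"] quad_closed[OF R, of "T2 x"] by simp_all
  \<comment> \<open>The new first part consists of \<open>v\<close> and \<open>V - S\<close>. With
    \<open>S\<close> frozen, \<open>g\<close> is constant, so \<open>B (x v) (g (T2 x))\<close> is
    additive through its left argument.\<close>
  have "additive_on ?W (?W - S) (\<lambda>x. Q (?T x))"
    unfolding additive_on_def
  proof (intro ballI impI)
    fix x y z assume x: "x \<in> ?W \<rightarrow> carrier L" and y: "y \<in> ?W \<rightarrow> carrier L" and z: "z \<in> ?W \<rightarrow> carrier L"
      and mult: "\<forall>i\<in>?W - S. z i = x i \<otimes> y i" and same: "\<forall>i\<in>?W - (?W - S). z i = x i \<and> y i = x i"
    have "z v = x v \<otimes> y v" using mult S insert.hyps by auto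
    moreover have "R (T2 z) = R (T2 x) \<otimes> R (T2 y)"
      by (rule additive_onD[OF R2 cl(4)[OF x] cl(4)[OF y] cl(4)[OF z]]) (use mult same in auto)
    moreover have "g (T2 z) = g (T2 x)" "g (T2 y) = g (T2 x)"
      using dep[OF cl(4)[OF z] cl(4)[OF x]] dep[OF cl(4)[OF y] cl(4)[OF x]] same S by auto
    ultimately show "Q (?T z) = Q (?T x) \<otimes> Q (?T y)"
      unfolding QT[OF x] QT[OF y] QT[OF z] using cl[OF x] cl[OF y]
      by (simp add: B_mult_left m_ac)
  qed
  \<comment> \<open>The complementary part is \<open>S\<close> itself. Now \<open>x v\<close> is
    frozen and additivity comes from the right argument of \<open>B\<close>, as \<open>g\<close> is
    additive on \<open>S\<close>.\<close>
  moreover have "additive_on ?W (?W - (?W - S)) (\<lambda>x. Q (?T x))"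
    unfolding additive_on_def
  proof (intro ballI impI)
    fix x y z assume x: "x \<in> ?W \<rightarrow> carrier L" and y: "y \<in> ?W \<rightarrow> carrier L" and z: "z \<in> ?W \<rightarrow> carrier L"
      and mult: "\<forall>i\<in>?W - (?W - S). z i = x i \<otimes> y i"
      and same: "\<forall>i\<in>?W - (?W - (?W - S)). z i = x i \<and> y i = x i"
    have "z v = x v" "y v = x v" using same S insert.hyps by auto
    moreover have "R (T2 z) = R (T2 x) \<otimes> R (T2 y)"
      by (rule additive_onD[OF R1 cl(4)[OF x] cl(4)[OF y] cl(4)[OF z]]) (use mult same S in auto)
    moreover have "g (T2 z) = g (T2 x) \<otimes> g (T2 y)"
      by (rule additive_onD[OF g1 cl(4)[OF x] cl(4)[OF y] cl(4)[OF z]]) (use mult same S in auto)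
    ultimately show "Q (?T z) = Q (?T x) \<otimes> Q (?T y)"
      unfolding QT[OF x] QT[OF y] QT[OF z] using cl[OF x] cl[OF y]
      by (simp add: B_mult_right m_ac)
  qed
  moreover have "lin_inj ?W ?T"
    by (rule lin_inj_comp[OF T1 lin_inj_mono[OF T2 subset_insertI]])
  moreover have "f (?T x) = f (?T y)"
    if "x \<in> ?W \<rightarrow> carrier L" "y \<in> ?W \<rightarrow> carrier L" "\<forall>i\<in>?W - S. x i = y i" for x y
  proof -
    have "x v = y v" using that(3) S insert.hyps(2) by blast
    then show ?thesis using fT[OF that(1)] fT[OF that(2)] by simp
  qed
  ultimately show ?case
    by (intro exI[of _ ?T] exI[of _ "?W - S"] conjI ballI impI Diff_subset) assumption+
qed

section \<open>Comparison of fibres\<close>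

text \<open>For each choice of the coordinates outside \<open>S\<close>, a nonempty fibre is a coset
  of a kernel. Dividing by a base point chosen for each such choice injects the whole fibre over
  \<open>c\<close> into the fibre over \<open>\<one>\<close>.\<close>

lemma additive_on_fibre_le:
  assumes "finite V" "finite (carrier L)" "S \<subseteq> V" and H: "additive_on V S H"
    and Hcl: "\<And>x. x \<in> V \<rightarrow> carrier L \<Longrightarrow> H x \<in> carrier L"
  shows "card {x \<in> V \<rightarrow>\<^sub>E carrier L. H x = c} \<le> card {x \<in> V \<rightarrow>\<^sub>E carrier L. H x = \<one>}"
proof -
  let ?P = "V \<rightarrow>\<^sub>E carrier L"
  let ?R = "\<lambda>x y. y \<in> ?P \<and> H y = c \<and> (\<forall>i\<in>V - S. y i = x i)"
  define s where "s x = (SOME y. ?R x y)" for x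
  define F where "F x = (\<lambda>i. if i \<in> S then x i \<otimes> inv (s x i) else x i)" for x
  have s: "s x \<in> ?P \<and> H (s x) = c \<and> (\<forall>i\<in>V - S. s x i = x i)"
    if "x \<in> ?P" "H x = c" for x
    unfolding s_def by (rule someI[of "?R x" x]) (use that in simp)
  have inj: "inj_on F {x \<in> ?P. H x = c}"
  proof (rule inj_onI)
    fix x y assume x: "x \<in> {x \<in> ?P. H x = c}" and y: "y \<in> {x \<in> ?P. H x = c}" and eq: "F x = F y"
    have off: "x i = y i" if "i \<notin> S" for i using fun_cong[OF eq, of i] that by (simp add: F_def)
    \<comment> \<open>The predicate behind the choice refers to \<open>x\<close> only through its
      values on \<open>V - S\<close>, so both points have the same base point.\<close>
    then have sxy: "s x = s y" unfolding s_def by simp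
    have "x i = y i" if i: "i \<in> S" for i
    proof -
      have "x i \<in> carrier L" "y i \<in> carrier L" "s y i \<in> carrier L"
        using i \<open>S \<subseteq> V\<close> x y s[of y] by (auto simp: PiE_iff)
      then show ?thesis using fun_cong[OF eq, of i] i by (simp add: F_def sxy)
    qed
    then show "x = y" using off by (metis ext)
  qed
  have image: "F ` {x \<in> ?P. H x = c} \<subseteq> {x \<in> ?P. H x = \<one>}"
  proof (rule image_subsetI)
    fix x assume "x \<in> {x \<in> ?P. H x = c}"
    then have x: "x \<in> ?P" and c: "c = H x" by auto
    have sx: "s x \<in> ?P" "H (s x) = c" "\<forall>i\<in>V - S. s x i = x i"
      using s[OF x c[symmetric]] by simp_all
    have cl: "x i \<in> carrier L" "s x i \<in> carrier L" if "i \<in> V" for i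
      using PiE_mem[OF x that] PiE_mem[OF sx(1) that] by simp_all
    have F: "F x \<in> ?P"
      using x cl \<open>S \<subseteq> V\<close> by (auto simp: F_def PiE_iff extensional_def)
    have cl': "x \<in> V \<rightarrow> carrier L" "F x \<in> V \<rightarrow> carrier L" "s x \<in> V \<rightarrow> carrier L"
      using F x sx(1) by (simp_all add: PiE_def)
    \<comment> \<open>On \<open>S\<close> the point \<open>x\<close> is the product of
      \<open>F x\<close> and its base point, and off \<open>S\<close> all three agree. Since
      \<open>H (s x) = H x\<close>, cancellation puts \<open>F x\<close> in the kernel.\<close>
    have "H x = H (F x) \<otimes> H (s x)"
    proof (rule additive_onD[OF H])
      show "x i = F x i \<otimes> s x i" if "i \<in> S" for i
        using that cl[of i] \<open>S \<subseteq> V\<close> by (auto simp: F_def m_assoc)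
      show "x i = F x i \<and> s x i = F x i" if "i \<in> V" "i \<notin> S" for i
        using that sx(3) by (simp add: F_def)
    qed (use cl' in simp_all)
    then have "H x = H (F x) \<otimes> H x" unfolding trans[OF sx(2) c] .
    then have "H (F x) = \<one>" using r_cancel_one'[OF Hcl[OF cl'(1)] Hcl[OF cl'(2)]] by (rule iffD1[rotated])
    then show "F x \<in> {x \<in> ?P. H x = \<one>}" using F by simp
  qed
  have "finite {x \<in> ?P. H x = \<one>}" using assms by (simp add: finite_PiE)
  then show ?thesis by (rule card_inj_on_le[OF inj image])
qed

text \<open>After the splitting change of variables both \<open>f\<close> and \<open>Q\<close> are
  additive on \<open>S\<close>, hence so is their product. The change permutes the assignments and
  so preserves fibre sizes.\<close>

lemma form_fibre_le:
  assumes V: "finite V" "finite (carrier L)" and f: "f \<in> lin V" and Q: "Q \<in> quad V"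
  shows "card {x \<in> V \<rightarrow>\<^sub>E carrier L. f x \<otimes> Q x = c} \<le> card {x \<in> V \<rightarrow>\<^sub>E carrier L. f x \<otimes> Q x = \<one>}"
proof -
  let ?P = "V \<rightarrow>\<^sub>E carrier L"
  obtain T S where T: "lin_inj V T" and S: "S \<subseteq> V"
    and dep': "\<forall>x\<in>V \<rightarrow> carrier L. \<forall>y\<in>V \<rightarrow> carrier L. (\<forall>i\<in>S. x i = y i) \<longrightarrow> f (T x) = f (T y)"
    and QS: "additive_on V S (\<lambda>x. Q (T x))"
    using lagrangian_splitting[OF V(1) f Q] by (elim exE conjE) (rule that)
  note dep = dep'[rule_format]
  let ?H = "\<lambda>x. f (T x) \<otimes> Q (T x)"
  have cl: "f (T x) \<in> carrier L" "Q (T x) \<in> carrier L" if "x \<in> V \<rightarrow> carrier L" for x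
    using lin_inj_closed[OF T order_refl that] lin_closed[OF f, of "T x"] quad_closed[OF Q, of "T x"]
    by simp_all
  have fS: "additive_on V S (\<lambda>x. f (T x))"
  proof (rule lin_additive_on[OF _ dep])
    show "(\<lambda>x. f (T x)) \<in> lin V"
      by (rule lin_subst[OF f lin_inj_lin[OF T order_refl]])
  qed
  have H: "additive_on V S ?H"
    unfolding additive_on_def
  proof (intro ballI impI)
    fix x y z assume *: "x \<in> V \<rightarrow> carrier L" "y \<in> V \<rightarrow> carrier L" "z \<in> V \<rightarrow> carrier L"
      "\<forall>i\<in>S. z i = x i \<otimes> y i" "\<forall>i\<in>V - S. z i = x i \<and> y i = x i"
    have "f (T z) = f (T x) \<otimes> f (T y)"
      by (rule additive_onD[OF fS *(1-3)]) (use *(4,5) in auto)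
    moreover have "Q (T z) = Q (T x) \<otimes> Q (T y)"
      by (rule additive_onD[OF QS *(1-3)]) (use *(4,5) in auto)
    ultimately show "?H z = ?H x \<otimes> ?H y" using cl[OF *(1)] cl[OF *(2)] by (simp add: m_ac)
  qed
  have bij: "bij_betw T ?P ?P" by (rule lin_inj_bij_betw[OF T V])
  have card: "card {x \<in> ?P. ?H x = d} = card {x \<in> ?P. f x \<otimes> Q x = d}" for d
  proof (rule bij_betw_same_card[of T])
    have "T ` {x \<in> ?P. ?H x = d} = {y \<in> T ` ?P. f y \<otimes> Q y = d}" by blast
    also have "T ` ?P = ?P" by (rule bij_betw_imp_surj_on[OF bij])
    finally have "T ` {x \<in> ?P. ?H x = d} = {x \<in> ?P. f x \<otimes> Q x = d}" .
    then show "bij_betw T {x \<in> ?P. ?H x = d} {x \<in> ?P. f x \<otimes> Q x = d}"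
      using inj_on_subset[OF bij_betw_imp_inj_on[OF bij], of "{x \<in> ?P. ?H x = d}"]
      by (simp add: bij_betw_def)
  qed
  show ?thesis
    using additive_on_fibre_le[OF V S H, of c] cl unfolding card by simp
qed

end

section \<open>Groups of class two and odd order\<close>

text \<open>Central commutators express class at most two, so abelian groups are included; odd order
  makes it possible to halve.\<close>

locale odd_class_two_group = group G for G (structure) +
  assumes odd_order: "odd (order G)"
    and commutator_central: "x \<in> carrier G \<Longrightarrow> y \<in> carrier G \<Longrightarrow> z \<in> carrier G \<Longrightarrow>
      (x \<otimes> y \<otimes> inv x \<otimes> inv y) \<otimes> z = z \<otimes> (x \<otimes> y \<otimes> inv x \<otimes> inv y)"
begin

section \<open>Commutators and their square roots\<close>

definition comm :: "'a \<Rightarrow> 'a \<Rightarrow> 'a" where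
  "comm x y = x \<otimes> y \<otimes> inv x \<otimes> inv y"

lemma comm_closed [simp]: "x \<in> carrier G \<Longrightarrow> y \<in> carrier G \<Longrightarrow> comm x y \<in> carrier G"
  by (simp add: comm_def)

lemma comm_commute: "x \<in> carrier G \<Longrightarrow> y \<in> carrier G \<Longrightarrow> z \<in> carrier G \<Longrightarrow> comm x y \<otimes> z = z \<otimes> comm x y"
  unfolding comm_def by (rule commutator_central)

lemma inv_mult_cancel [simp]:
  assumes "x \<in> carrier G" "y \<in> carrier G"
  shows "inv x \<otimes> (x \<otimes> y) = y" "x \<otimes> (inv x \<otimes> y) = y"
  using assms by (simp_all add: m_assoc[symmetric])

lemma comm_eq_one:
  assumes "x \<in> carrier G" "y \<in> carrier G" "x \<otimes> y = y \<otimes> x"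
  shows "comm x y = \<one>"
  using assms by (simp add: comm_def m_assoc)

lemma comm_swap: "x \<in> carrier G \<Longrightarrow> y \<in> carrier G \<Longrightarrow> comm y x = inv (comm x y)"
  by (simp add: comm_def inv_mult_group m_assoc)

lemma mult_eq_comm: "x \<in> carrier G \<Longrightarrow> y \<in> carrier G \<Longrightarrow> x \<otimes> y = comm x y \<otimes> (y \<otimes> x)"
  by (simp add: comm_def m_assoc)

text \<open>In the expanded left side \<open>comm y z\<close> appears between \<open>x\<close> and
  its inverse; being central, it can be moved out.\<close>

lemma comm_mult_left:
  assumes "x \<in> carrier G" "y \<in> carrier G" "z \<in> carrier G"
  shows "comm (x \<otimes> y) z = comm x z \<otimes> comm y z"
proof -
  have "comm (x \<otimes> y) z = x \<otimes> comm y z \<otimes> (z \<otimes> inv x \<otimes> inv z)"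
    using assms by (simp add: comm_def inv_mult_group m_assoc)
  also have "\<dots> = comm y z \<otimes> x \<otimes> (z \<otimes> inv x \<otimes> inv z)"
    using assms by (simp add: comm_commute[of y z x])
  also have "\<dots> = comm y z \<otimes> comm x z"
    using assms by (simp add: comm_def[of x] m_assoc)
  finally show ?thesis using assms by (simp add: comm_commute[of x z "comm y z"])
qed

text \<open>For odd \<open>order G\<close> the exponent is an inverse of 2 modulo the group
  order.\<close>

definition half_comm :: "'a \<Rightarrow> 'a \<Rightarrow> 'a" where
  "half_comm x y = comm x y [^] ((order G + 1) div 2)"

lemma half_comm_closed [simp]: "x \<in> carrier G \<Longrightarrow> y \<in> carrier G \<Longrightarrow> half_comm x y \<in> carrier G"
  by (simp add: half_comm_def)

lemma half_comm_commute:
  assumes "x \<in> carrier G" "y \<in> carrier G" "z \<in> carrier G"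
  shows "half_comm x y \<otimes> z = z \<otimes> half_comm x y"
proof -
  have "comm x y [^] (j::nat) \<otimes> z = z \<otimes> comm x y [^] j" for j
    by (rule group_commutes_pow) (use assms in \<open>auto simp: comm_commute\<close>)
  then show ?thesis by (simp add: half_comm_def)
qed

lemma half_comm_eq_one:
  "x \<in> carrier G \<Longrightarrow> y \<in> carrier G \<Longrightarrow> x \<otimes> y = y \<otimes> x \<Longrightarrow> half_comm x y = \<one>"
  by (simp add: half_comm_def comm_eq_one)

lemma half_comm_swap: "x \<in> carrier G \<Longrightarrow> y \<in> carrier G \<Longrightarrow> half_comm y x = inv (half_comm x y)"
  unfolding half_comm_def by (subst comm_swap) (simp_all add: nat_pow_inv)

lemma half_comm_mult_left:
  assumes "x \<in> carrier G" "y \<in> carrier G" "z \<in> carrier G"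
  shows "half_comm (x \<otimes> y) z = half_comm x z \<otimes> half_comm y z"
  unfolding half_comm_def comm_mult_left[OF assms]
  using assms by (intro pow_mult_distrib comm_commute comm_closed)

lemma half_comm_mult_right:
  assumes "x \<in> carrier G" "y \<in> carrier G" "z \<in> carrier G"
  shows "half_comm x (y \<otimes> z) = half_comm x y \<otimes> half_comm x z"
proof -
  have "half_comm x (y \<otimes> z) = half_comm x z \<otimes> half_comm x y"
    using assms by (simp add: half_comm_swap[of "y \<otimes> z" x] half_comm_swap[of y x]
      half_comm_swap[of z x] half_comm_mult_left inv_mult_group)
  also have "\<dots> = half_comm x y \<otimes> half_comm x z"
    using assms by (intro half_comm_commute half_comm_closed)
  finally show ?thesis .
qed

text \<open>Powers of commutators are central, and commuting elements have trivial
  \<open>half_comm\<close>. This makes nested correction terms of the Baer sum disappear.\<close>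

lemma half_comm_half_comm:
  assumes "x \<in> carrier G" "y \<in> carrier G" "z \<in> carrier G"
  shows "half_comm (half_comm x y) z = \<one>" "half_comm z (half_comm x y) = \<one>"
  using assms by (simp_all add: half_comm_eq_one half_comm_commute[of x y z])

lemma half_comm_square:
  assumes "x \<in> carrier G" "y \<in> carrier G"
  shows "half_comm x y \<otimes> half_comm x y = comm x y"
proof -
  have "(order G + 1) div 2 + (order G + 1) div 2 = order G + 1"
    using odd_order by presburger
  then have "half_comm x y \<otimes> half_comm x y = comm x y [^] (order G + 1)"
    using assms by (simp only: half_comm_def nat_pow_mult comm_closed)
  then show ?thesis using assms by (simp add: pow_order_eq_1)
qed

text \<open>
  Baer's construction: as \<open>half_comm\<close> is a square root of the commutator, dividing the product by
  it yields an abelian group.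
\<close>

definition baer_group :: "'a monoid" where
  "baer_group = \<lparr>carrier = carrier G, monoid.mult = (\<lambda>x y. x \<otimes> y \<otimes> half_comm y x), one = \<one>\<rparr>"

lemma baer_carrier [simp]: "carrier baer_group = carrier G"
  and baer_one [simp]: "\<one>\<^bsub>baer_group\<^esub> = \<one>"
  and baer_mult: "x \<otimes>\<^bsub>baer_group\<^esub> y = x \<otimes> y \<otimes> half_comm y x"
  by (simp_all add: baer_group_def)

lemma baer_mult_central:
  assumes "x \<in> carrier G" "y \<in> carrier G" "z \<in> carrier G"
  shows "x \<otimes>\<^bsub>baer_group\<^esub> half_comm y z = x \<otimes> half_comm y z"
  using assms by (simp add: baer_mult half_comm_half_comm)

text \<open>The inverse direction of Baer's correspondence; this identity turns words into sums of a
  linear and a quadratic form.\<close>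

lemma mult_eq_baer:
  assumes "x \<in> carrier G" "y \<in> carrier G"
  shows "x \<otimes> y = (x \<otimes>\<^bsub>baer_group\<^esub> y) \<otimes>\<^bsub>baer_group\<^esub> half_comm x y"
proof -
  have "half_comm x y \<otimes> half_comm y x = \<one>" "half_comm y x \<otimes> half_comm x y = \<one>"
    using assms by (simp_all add: half_comm_swap[of x y])
  moreover have "(x \<otimes>\<^bsub>baer_group\<^esub> y) \<otimes>\<^bsub>baer_group\<^esub> half_comm x y = x \<otimes> y \<otimes> half_comm y x \<otimes> half_comm x y"
    using assms by (subst baer_mult_central) (simp_all add: baer_mult)
  ultimately show ?thesis using assms by (simp add: m_assoc)
qed

text \<open>Exchanging \<open>x\<close> and \<open>y\<close> costs \<open>comm x y\<close>, the
  square of \<open>half_comm x y\<close>. One factor cancels against the correction on the left, the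
  other is the correction on the right.\<close>

lemma baer_m_comm:
  assumes "x \<in> carrier G" "y \<in> carrier G"
  shows "x \<otimes>\<^bsub>baer_group\<^esub> y = y \<otimes>\<^bsub>baer_group\<^esub> x"
proof -
  have "x \<otimes> y \<otimes> half_comm y x = (half_comm x y \<otimes> half_comm x y) \<otimes> (y \<otimes> x) \<otimes> inv (half_comm x y)"
    using assms by (simp add: half_comm_square mult_eq_comm[of x y] half_comm_swap[of x y])
  also have "\<dots> = half_comm x y \<otimes> (half_comm x y \<otimes> (y \<otimes> x \<otimes> inv (half_comm x y)))"
    using assms by (simp add: m_assoc)
  also have "half_comm x y \<otimes> (y \<otimes> x \<otimes> inv (half_comm x y)) = y \<otimes> x \<otimes> inv (half_comm x y) \<otimes> half_comm x y"
    using assms by (intro half_comm_commute) simp_all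
  also have "\<dots> = y \<otimes> x" using assms by (simp add: m_assoc)
  also have "half_comm x y \<otimes> (y \<otimes> x) = y \<otimes> x \<otimes> half_comm x y"
    using assms by (intro half_comm_commute) simp_all
  finally show ?thesis by (simp add: baer_mult)
qed

text \<open>Both bracketings equal the product of \<open>x\<close>, \<open>y\<close> and
  \<open>z\<close> times the same three central corrections, one for each pair.\<close>

lemma baer_m_assoc:
  assumes "x \<in> carrier G" "y \<in> carrier G" "z \<in> carrier G"
  shows "(x \<otimes>\<^bsub>baer_group\<^esub> y) \<otimes>\<^bsub>baer_group\<^esub> z = x \<otimes>\<^bsub>baer_group\<^esub> (y \<otimes>\<^bsub>baer_group\<^esub> z)"
proof -
  let ?a = "half_comm y x" and ?b = "half_comm z x" and ?c = "half_comm z y"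
  have "(x \<otimes>\<^bsub>baer_group\<^esub> y) \<otimes>\<^bsub>baer_group\<^esub> z = x \<otimes> y \<otimes> (?a \<otimes> z) \<otimes> (?b \<otimes> ?c)"
    using assms by (simp add: baer_mult half_comm_mult_right half_comm_half_comm m_assoc)
  also have "?a \<otimes> z = z \<otimes> ?a" using assms by (intro half_comm_commute)
  also have "x \<otimes> y \<otimes> (z \<otimes> ?a) \<otimes> (?b \<otimes> ?c) = x \<otimes> (y \<otimes> z) \<otimes> ((?a \<otimes> ?b) \<otimes> ?c)"
    using assms by (simp add: m_assoc)
  also have "(?a \<otimes> ?b) \<otimes> ?c = ?c \<otimes> (?a \<otimes> ?b)"
    using assms by (intro half_comm_commute[symmetric]) simp_all
  also have "x \<otimes> (y \<otimes> z) \<otimes> (?c \<otimes> (?a \<otimes> ?b)) = x \<otimes>\<^bsub>baer_group\<^esub> (y \<otimes>\<^bsub>baer_group\<^esub> z)"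
    using assms by (simp add: baer_mult half_comm_mult_left half_comm_half_comm m_assoc)
  finally show ?thesis .
qed

text \<open>Biadditivity carries over from the group product to the Baer sum, because the central
  correction factor contributes nothing inside \<open>half_comm\<close>.\<close>

lemma alternating_baer: "alternating_comm_group baer_group half_comm"
proof -
  interpret L: comm_group baer_group
  proof (rule comm_groupI)
    fix x assume "x \<in> carrier baer_group"
    then show "\<exists>y\<in>carrier baer_group. y \<otimes>\<^bsub>baer_group\<^esub> x = \<one>\<^bsub>baer_group\<^esub>"
      by (intro bexI[of _ "inv x"]) (simp_all add: baer_mult half_comm_eq_one)
  next
    fix x y z assume "x \<in> carrier baer_group" "y \<in> carrier baer_group" "z \<in> carrier baer_group"
    then show "x \<otimes>\<^bsub>baer_group\<^esub> y \<otimes>\<^bsub>baer_group\<^esub> z = x \<otimes>\<^bsub>baer_group\<^esub> (y \<otimes>\<^bsub>baer_group\<^esub> z)"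
      by (intro baer_m_assoc) simp_all
  next
    fix x y assume "x \<in> carrier baer_group" "y \<in> carrier baer_group"
    then show "x \<otimes>\<^bsub>baer_group\<^esub> y = y \<otimes>\<^bsub>baer_group\<^esub> x"
      by (intro baer_m_comm) simp_all
  qed (simp_all add: baer_mult half_comm_eq_one)
  show ?thesis
    by unfold_locales
      (auto simp: baer_mult_central half_comm_eq_one baer_mult half_comm_mult_left
        half_comm_mult_right half_comm_half_comm)
qed

lemma baer_inv: "x \<in> carrier G \<Longrightarrow> inv\<^bsub>baer_group\<^esub> x = inv x"
proof -
  assume x: "x \<in> carrier G"
  interpret L: alternating_comm_group baer_group half_comm by (rule alternating_baer)
  show ?thesis using x by (intro L.inv_equality) (simp_all add: baer_mult half_comm_eq_one)
qed

section \<open>Word maps as forms\<close>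

text \<open>Induction over the letters: prepending a letter with value \<open>l\<close> adds
  \<open>l\<close> to the linear part and \<open>half_comm l f\<close> to the quadratic
  part.\<close>

lemma word_value_form:
  fixes V :: "'i set"
  assumes "fst ` set w \<subseteq> V"
  shows "\<exists>f\<in>alternating_comm_group.lin baer_group V.
    \<exists>Q\<in>alternating_comm_group.quad baer_group half_comm V.
      \<forall>g\<in>V \<rightarrow> carrier G. word_value G g w = f g \<otimes>\<^bsub>baer_group\<^esub> Q g"
proof -
  interpret L: alternating_comm_group baer_group half_comm by (rule alternating_baer)
  \<comment> \<open>Values of quadratic forms lie in the radical of \<open>half_comm\<close>, so a
    new letter interacts only with the linear part of the rest of the word.\<close>
  have quad_central: "half_comm z (Q g) = \<one>"
    if "Q \<in> L.quad V" "z \<in> carrier G" "g \<in> V \<rightarrow> carrier G" for Q z and g :: "'i \<Rightarrow> 'a"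
    using that(1)
  proof (induction rule: L.quad.induct)
    case quad_one
    show ?case using that by (simp add: half_comm_eq_one)
  next
    case (quad_B f h)
    then show ?case using that L.lin_closed[of f V g] L.lin_closed[of h V g]
      by (simp add: half_comm_half_comm)
  next
    case (quad_mult Q R)
    then show ?case using that L.quad_closed[of Q V g] L.quad_closed[of R V g] L.B_mult_right[of z "Q g" "R g"]
      by simp
  qed
  show ?thesis using assms
  proof (induction w)
    case Nil
    show ?case
      by (intro bexI[of _ "\<lambda>x. \<one>"])
        (use L.lin.lin_one L.quad.quad_one L.l_one in \<open>simp_all add: word_value_def\<close>)
  next
    case (Cons a w)
    then obtain f Q where f: "f \<in> L.lin V" and Q: "Q \<in> L.quad V"
      and eq: "\<And>g. g \<in> V \<rightarrow> carrier G \<Longrightarrow> word_value G g w = f g \<otimes>\<^bsub>baer_group\<^esub> Q g"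
      by auto
    \<comment> \<open>The Baer inverse makes \<open>l\<close> visibly a linear form; it coincides
      with the group inverse used in \<open>letter_value\<close>.\<close>
    define l where "l g = (if snd a then g (fst a) else inv\<^bsub>baer_group\<^esub> (g (fst a)))" for g :: "'i \<Rightarrow> 'a"
    have l: "l \<in> L.lin V"
      using Cons.prems L.lin.lin_inv[OF L.lin.lin_proj[of "fst a" V]] L.lin.lin_proj[of "fst a" V]
      unfolding l_def by (cases "snd a") simp_all
    have "word_value G g (a # w) =
        (l g \<otimes>\<^bsub>baer_group\<^esub> f g) \<otimes>\<^bsub>baer_group\<^esub> (Q g \<otimes>\<^bsub>baer_group\<^esub> half_comm (l g) (f g))"
      if g: "g \<in> V \<rightarrow> carrier G" for g
    proof -
      have cl: "l g \<in> carrier G" "f g \<in> carrier G" "Q g \<in> carrier G"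
        using g L.lin_closed[OF l] L.lin_closed[OF f] L.quad_closed[OF Q] by auto
      have "letter_value G g a = l g"
        using baer_inv[of "g (fst a)"] g Cons.prems by (simp add: letter_value_def l_def Pi_iff)
      then have "word_value G g (a # w) = l g \<otimes> (f g \<otimes>\<^bsub>baer_group\<^esub> Q g)"
        using eq[OF g] by (simp add: word_value_def)
      also have "\<dots> = l g \<otimes>\<^bsub>baer_group\<^esub> (f g \<otimes>\<^bsub>baer_group\<^esub> Q g)
          \<otimes>\<^bsub>baer_group\<^esub> half_comm (l g) (f g \<otimes>\<^bsub>baer_group\<^esub> Q g)"
        using cl L.m_closed[of "f g" "Q g"] by (intro mult_eq_baer) simp_all
      also have "half_comm (l g) (f g \<otimes>\<^bsub>baer_group\<^esub> Q g) = half_comm (l g) (f g)"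
        using cl quad_central[OF Q cl(1) g] L.B_mult_right[of "l g" "f g" "Q g"] L.r_one by simp
      finally show ?thesis using cl L.m_assoc L.m_closed by simp
    qed
    then show ?case
      using L.lin.lin_mult[OF l f] L.quad.quad_mult[OF Q L.quad.quad_B[OF l f]]
      by (intro bexI[of _ "\<lambda>g. l g \<otimes>\<^bsub>baer_group\<^esub> f g"]
          bexI[of _ "\<lambda>g. Q g \<otimes>\<^bsub>baer_group\<^esub> half_comm (l g) (f g)"] ballI) simp_all
  qed
qed

text \<open>The fibres of the word map are those of its form, and \<open>G\<close> and its Baer
  group share the neutral element.\<close>

lemma word_fibre_count_le:
  assumes "finite (carrier G)" "w \<in> carrier (free_group {1..k})"
  shows "word_fibre_count G k w c \<le> word_fibre_count G k w \<one>"
proof -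
  interpret L: alternating_comm_group baer_group half_comm by (rule alternating_baer)
  obtain f Q where f: "f \<in> L.lin {1..k}" and Q: "Q \<in> L.quad {1..k}"
    and eq: "\<And>g. g \<in> {1..k} \<rightarrow> carrier G \<Longrightarrow> word_value G g w = f g \<otimes>\<^bsub>baer_group\<^esub> Q g"
    using word_value_form[of w "{1..k}"] assms(2) by (auto simp: free_group_def)
  have "word_fibre_count G k w d = card {g \<in> tuples G k. f g \<otimes>\<^bsub>baer_group\<^esub> Q g = d}" for d
    unfolding word_fibre_count_def using eq by (intro arg_cong[of _ _ card]) (auto simp: PiE_def)
  then show ?thesis using L.form_fibre_le[OF _ _ f Q, of c] assms(1) by simp
qed

end

section \<open>Counting tuples by their word values\<close>

theorem mainTheorem4:
  fixes G :: "('a, 'b) monoid_scheme" and p k :: nat and w :: "nat letter list"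
  assumes "prime p" and "odd p"
    and "finite_p_group p G"
    and "has_nilpotency_class G 2"
    and "k \<ge> 1"
    and "w \<in> carrier (free_group {1..k})"
  shows "real (word_fibre_count G k w \<one>\<^bsub>G\<^esub>) \<ge> real (order G) ^ k / real (card (word_values G k w))"
proof -
  interpret group G using assms(3) by (simp add: finite_p_group_def)
  have fin: "finite (carrier G)" using assms(3) by (simp add: finite_p_group_def)
  interpret odd_class_two_group G
  proof
    show "odd (order G)" using assms(2,3) by (auto simp: finite_p_group_def)
  next
    fix x y z assume xyz: "x \<in> carrier G" "y \<in> carrier G" "z \<in> carrier G"
    define c where "c = x \<otimes>\<^bsub>G\<^esub> y \<otimes>\<^bsub>G\<^esub> inv\<^bsub>G\<^esub> x \<otimes>\<^bsub>G\<^esub> inv\<^bsub>G\<^esub> y"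
    have cl: "c \<in> carrier G" using xyz by (simp add: c_def)
    \<comment> \<open>The series is indexed from 0: index 1 is the derived subgroup and index 2 is
      trivial, so the commutator of \<open>c\<close> with any \<open>z\<close> vanishes.\<close>
    have "c \<in> lower_central G 1"
      using xyz unfolding c_def One_nat_def lower_central.simps by (blast intro: generate.incl)
    then have "c \<otimes>\<^bsub>G\<^esub> z \<otimes>\<^bsub>G\<^esub> inv\<^bsub>G\<^esub> c \<otimes>\<^bsub>G\<^esub> inv\<^bsub>G\<^esub> z \<in> lower_central G (Suc 1)"
      using xyz(3) unfolding lower_central.simps(2)[of G 1] by (blast intro: generate.incl)
    then have "c \<otimes>\<^bsub>G\<^esub> z \<otimes>\<^bsub>G\<^esub> inv\<^bsub>G\<^esub> c \<otimes>\<^bsub>G\<^esub> inv\<^bsub>G\<^esub> z = \<one>\<^bsub>G\<^esub>"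
      using assms(4) by (simp add: has_nilpotency_class_def numeral_2_eq_2)
    then have "(c \<otimes>\<^bsub>G\<^esub> z) \<otimes>\<^bsub>G\<^esub> inv\<^bsub>G\<^esub> (z \<otimes>\<^bsub>G\<^esub> c) = \<one>\<^bsub>G\<^esub>"
      using cl xyz by (simp add: inv_mult_group m_assoc)
    then show "x \<otimes>\<^bsub>G\<^esub> y \<otimes>\<^bsub>G\<^esub> inv\<^bsub>G\<^esub> x \<otimes>\<^bsub>G\<^esub> inv\<^bsub>G\<^esub> y \<otimes>\<^bsub>G\<^esub> z
        = z \<otimes>\<^bsub>G\<^esub> (x \<otimes>\<^bsub>G\<^esub> y \<otimes>\<^bsub>G\<^esub> inv\<^bsub>G\<^esub> x \<otimes>\<^bsub>G\<^esub> inv\<^bsub>G\<^esub> y)"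
      using cl xyz inv_solve_right[of "\<one>\<^bsub>G\<^esub>" "c \<otimes>\<^bsub>G\<^esub> z" "z \<otimes>\<^bsub>G\<^esub> c"] by (simp add: c_def[symmetric])
  qed
  let ?P = "tuples G k" and ?W = "word_values G k w"
  have P: "finite ?P" using fin by (simp add: finite_PiE)
  have W: "?W = (\<lambda>g. word_value G g w) ` ?P" by (auto simp: word_values_def)
  \<comment> \<open>The tuples are partitioned into the fibres over the word values, each at most as
    large as the fibre over the identity.\<close>
  have "card ?P = (\<Sum>c\<in>?W. word_fibre_count G k w c)"
    unfolding word_fibre_count_def W
    using sum.group[OF P finite_imageI[OF P, of "\<lambda>g. word_value G g w"] subset_refl, of "\<lambda>_. 1::nat"]
    by simp
  also have "\<dots> \<le> card ?W * word_fibre_count G k w \<one>\<^bsub>G\<^esub>"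
    using sum_bounded_above[of ?W "word_fibre_count G k w" "word_fibre_count G k w \<one>\<^bsub>G\<^esub>"]
      word_fibre_count_le[OF fin assms(6)] by simp
  finally have "order G ^ k \<le> card ?W * word_fibre_count G k w \<one>\<^bsub>G\<^esub>"
    by (simp add: card_PiE order_def)
  then have "real (order G) ^ k \<le> real (card ?W) * real (word_fibre_count G k w \<one>\<^bsub>G\<^esub>)"
    by (metis of_nat_le_iff of_nat_mult of_nat_power)
  \<comment> \<open>Positivity, witnessed by the value at the constant identity tuple, allows
    division by the number of word values.\<close>
  moreover have "card ?W > 0"
  proof -
    have "(\<lambda>i\<in>{1..k}. \<one>\<^bsub>G\<^esub>) \<in> ?P" by simp
    then show ?thesis using P unfolding W card_gt_0_iff by blast
  qed
  ultimately show ?thesis by (simp add: divide_le_eq mult.commute)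
qed

end
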